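(* Let $a>0$ and $b>0$, and put $E(x)=e^{-ax^{2}-bx}$, $W(x)=\sqrt\pi\,e^{\frac{b^{2}}{4a}}\operatorname{erf}\left(\frac{2ax+b}{2\sqrt a}\right)$ and $P(x)=\frac{945}{b^{5}x^{5}}+\frac{945}{b^{4}x^{4}}+\frac{420}{b^{3}x^{3}}+\frac{105}{b^{2}x^{2}}+\frac{15}{bx}+1$. For $p\in\{3,1,-1,-3,-5\}$, on $(0,\infty)$, $$\sqrt{\tfrac{2}{\pi}}\int e^{-ax^{2}}b^{5+\frac12}x^{p+\frac12}K_{\frac{11}2}(bx)\,dx=b^{5}\int x^{p}P(x)E(x)\,dx=V_p(x),$$ where $$V_{3}(x)=-E(x)\left(\frac{x(60a^{2}b^{4}-2ab^{6})}{8a^{3}}+\frac{420a^{2}b^{3}-26ab^{5}+b^{7}}{8a^{3}}+\frac{b^{5}x^{2}}{2a}+\frac{945}{x}\right)-\frac{(15120a^{4}-3360a^{3}b^{2}+360a^{2}b^{4}-24ab^{6}+b^{8})W(x)}{16a^{7/2}},$$ $$V_{1}(x)=-E(x)\left(\frac{210ab^{2}-1260a^{2}}{2ax}+\frac{b^{5}}{2a}+\frac{315b}{x^{2}}+\frac{315}{x^{3}}\right)+\frac{(2520a^{3}-420a^{2}b^{2}+30ab^{4}-b^{6})W(x)}{4a^{3/2}},$$ $$V_{-1}(x)=E(x)\left(\frac{-252a^{2}+28ab^{2}-b^{4}}{x}+\frac{126ab-14b^{3}}{x^{2}}+\frac{126a-77b^{2}}{x^{3}}-\frac{189b}{x^{4}}-\frac{189}{x^{5}}\right)-\sqrt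 a\,(252a^{2}-28ab^{2}+b^{4})W(x),$$ $$V_{-3}(x)=E(x)\left(\frac{2ab^{3}-36a^{2}b}{x^{2}}+\frac{-36a^{2}+20ab^{2}-b^{4}}{x^{3}}+\frac{72a^{3}-4a^{2}b^{2}}{x}+\frac{54ab-12b^{3}}{x^{4}}+\frac{54a-57b^{2}}{x^{5}}-\frac{135b}{x^{6}}-\frac{135}{x^{7}}\right)+4a^{5/2}(18a-b^{2})W(x),$$ $$V_{-5}(x)=E(x)\left(-\frac{16a^{4}}{x}+\frac{8a^{3}b}{x^{2}}-\frac{4(a^{2}b^{2}-2a^{3})}{x^{3}}+\frac{2(ab^{3}-6a^{2}b)}{x^{4}}+\frac{-12a^{2}+12ab^{2}-b^{4}}{x^{5}}-\frac{10(b^{3}-3ab)}{x^{6}}-\frac{15(3b^{2}-2a)}{x^{7}}-\frac{105b}{x^{8}}-\frac{105}{x^{9}}\right)-16a^{9/2}W(x).$$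
   Context: $K_\mu$ is the Macdonald function (modified Bessel function of the second kind); $\operatorname{erf}(z)=\frac{2}{\sqrt\pi}\int_0^z e^{-t^2}dt$. An identity $\int f\,dx=\int g\,dx=F$ means that $f=g$ on $(0,\infty)$ and that $F$ is an antiderivative of this function on $(0,\infty)$. *)

theory Defs
  imports "HOL-Analysis.Analysis"
begin

(* Only values at z > 0 are meaningful. rGamma = 1/Gamma vanishes at the
   poles of Gamma, so the series is the usual one for every real order. *)
definition bessel_I :: "real \<Rightarrow> real \<Rightarrow> real" where
  "bessel_I \<mu> z = (z / 2) powr \<mu> *
     (\<Sum>k. rGamma (\<mu> + real k + 1) * (z / 2) ^ (2 * k) / fact k)"

definition macdonald_quotient :: "real \<Rightarrow> real \<Rightarrow> real" where
  "macdonald_quotient \<mu> z = pi / 2 * (bessel_I (- \<mu>) z - bessel_I \<mu> z) / sin (\<mu> * pi)"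

definition macdonald_K :: "real \<Rightarrow> real \<Rightarrow> real" where
  "macdonald_K \<mu> z =
     (if \<mu> \<in> \<int> then Lim (at \<mu>) (\<lambda>\<nu>. macdonald_quotient \<nu> z)
      else macdonald_quotient \<mu> z)"

(* The interval integral is oriented, so this is also correct for z < 0. *)
definition erf :: "real \<Rightarrow> real" where
  "erf z = 2 / sqrt pi * (LBINT t=0..z. exp (- t\<^sup>2))"

definition fE :: "real \<Rightarrow> real \<Rightarrow> real \<Rightarrow> real" where
  "fE a b x = exp (- a * x\<^sup>2 - b * x)"

definition fW :: "real \<Rightarrow> real \<Rightarrow> real \<Rightarrow> real" where
  "fW a b x = sqrt pi * exp (b\<^sup>2 / (4 * a)) * erf ((2 * a * x + b) / (2 * sqrt a))"

definition fP :: "real \<Rightarrow> real \<Rightarrow> real" where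
  "fP b x = 945 / (b ^ 5 * x ^ 5) + 945 / (b ^ 4 * x ^ 4) + 420 / (b ^ 3 * x ^ 3)
     + 105 / (b\<^sup>2 * x\<^sup>2) + 15 / (b * x) + 1"

definition V3 :: "real \<Rightarrow> real \<Rightarrow> real \<Rightarrow> real" where
  "V3 a b x =
     - fE a b x *
       (x * (60 * a\<^sup>2 * b ^ 4 - 2 * a * b ^ 6) / (8 * a ^ 3)
        + (420 * a\<^sup>2 * b ^ 3 - 26 * a * b ^ 5 + b ^ 7) / (8 * a ^ 3)
        + b ^ 5 * x\<^sup>2 / (2 * a)
        + 945 / x)
     - (15120 * a ^ 4 - 3360 * a ^ 3 * b\<^sup>2 + 360 * a\<^sup>2 * b ^ 4 - 24 * a * b ^ 6 + b ^ 8)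
         * fW a b x / (16 * a powr (7 / 2))"

definition V1 :: "real \<Rightarrow> real \<Rightarrow> real \<Rightarrow> real" where
  "V1 a b x =
     - fE a b x *
       ((210 * a * b\<^sup>2 - 1260 * a\<^sup>2) / (2 * a * x)
        + b ^ 5 / (2 * a)
        + 315 * b / x\<^sup>2
        + 315 / x ^ 3)
     + (2520 * a ^ 3 - 420 * a\<^sup>2 * b\<^sup>2 + 30 * a * b ^ 4 - b ^ 6)
         * fW a b x / (4 * a powr (3 / 2))"

definition Vm1 :: "real \<Rightarrow> real \<Rightarrow> real \<Rightarrow> real" where
  "Vm1 a b x =
     fE a b x *
       ((- 252 * a\<^sup>2 + 28 * a * b\<^sup>2 - b ^ 4) / x
        + (126 * a * b - 14 * b ^ 3) / x\<^sup>2
        + (126 * a - 77 * b\<^sup>2) / x ^ 3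
        - 189 * b / x ^ 4
        - 189 / x ^ 5)
     - sqrt a * (252 * a\<^sup>2 - 28 * a * b\<^sup>2 + b ^ 4) * fW a b x"

definition Vm3 :: "real \<Rightarrow> real \<Rightarrow> real \<Rightarrow> real" where
  "Vm3 a b x =
     fE a b x *
       ((2 * a * b ^ 3 - 36 * a\<^sup>2 * b) / x\<^sup>2
        + (- 36 * a\<^sup>2 + 20 * a * b\<^sup>2 - b ^ 4) / x ^ 3
        + (72 * a ^ 3 - 4 * a\<^sup>2 * b\<^sup>2) / x
        + (54 * a * b - 12 * b ^ 3) / x ^ 4
        + (54 * a - 57 * b\<^sup>2) / x ^ 5
        - 135 * b / x ^ 6
        - 135 / x ^ 7)
     + 4 * a powr (5 / 2) * (18 * a - b\<^sup>2) * fW a b x"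

definition Vm5 :: "real \<Rightarrow> real \<Rightarrow> real \<Rightarrow> real" where
  "Vm5 a b x =
     fE a b x *
       (- (16 * a ^ 4 / x)
        + 8 * a ^ 3 * b / x\<^sup>2
        - 4 * (a\<^sup>2 * b\<^sup>2 - 2 * a ^ 3) / x ^ 3
        + 2 * (a * b ^ 3 - 6 * a\<^sup>2 * b) / x ^ 4
        + (- 12 * a\<^sup>2 + 12 * a * b\<^sup>2 - b ^ 4) / x ^ 5
        - 10 * (b ^ 3 - 3 * a * b) / x ^ 6
        - 15 * (3 * b\<^sup>2 - 2 * a) / x ^ 7
        - 105 * b / x ^ 8
        - 105 / x ^ 9)
     - 16 * a powr (9 / 2) * fW a b x"

(* Only p = 3, 1, -1, -3, -5 are meant; the last branch stands for p = -5. *)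
definition V :: "int \<Rightarrow> real \<Rightarrow> real \<Rightarrow> real \<Rightarrow> real" where
  "V p = (if p = 3 then V3 else if p = 1 then V1 else if p = - 1 then Vm1
          else if p = - 3 then Vm3 else Vm5)"

end

theory Submission
  imports Defs
begin

text \<open>
  The Gamma recurrence turns the power series of \<open>bessel_I\<close> into the three-term recurrence of
  the Bessel functions. Together with the elementary orders \<open>\<plusminus>1/2\<close>, whose series are those of
  \<open>cosh\<close> and \<open>sinh\<close>, five steps of it give \<open>macdonald_K (11/2)\<close> in closed form. As \<open>fW\<close> has
  derivative \<open>2 * sqrt a * fE\<close>, the antiderivatives reduce to identities of rational functions.
\<close>

section \<open>Bessel functions of half-integer order\<close>

text \<open>Ratio test: since \<open>rGamma y = y * rGamma (y + 1)\<close>, each term is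
  \<open>w / ((\<mu> + k + 1) * (k + 1))\<close> times the preceding one once
  \<open>\<mu> + k + 1\<close> is positive.\<close>

lemma summable_bessel:
  fixes \<mu> w :: real
  shows "summable (\<lambda>k. rGamma (\<mu> + real k + 1) * w ^ k / fact k)"
proof -
  \<comment> \<open>This bound serves both factors of the ratio: from \<open>N\<close> on,
    \<open>\<mu> + k + 1 \<ge> 1\<close> and \<open>\<bar>w\<bar> \<le> (k + 1) / 2\<close>.\<close>
  obtain N :: nat where N: "real N \<ge> \<bar>\<mu>\<bar> + 2 * \<bar>w\<bar>"
    using real_arch_simple by blast
  show ?thesis
  proof (rule summable_ratio_test[of "1/2" N])
    fix k assume "k \<ge> N"
    then have k: "real k \<ge> \<bar>\<mu>\<bar> + 2 * \<bar>w\<bar>" using N by linarith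
    define g where "g = rGamma (\<mu> + real (Suc k) + 1)"
    have rec: "rGamma (\<mu> + real k + 1) = (\<mu> + real k + 1) * g"
      using rGamma_plus1[of "\<mu> + real k + 1"] by (simp add: g_def algebra_simps)
    have "\<bar>w\<bar> \<le> 1/2 * 1 * (real k + 1)"
      using k by simp
    also have "\<dots> \<le> 1/2 * (\<mu> + real k + 1) * (real k + 1)"
      by (intro mult_right_mono mult_left_mono) (use k in auto)
    finally have "\<bar>w\<bar> / (real k + 1) \<le> 1/2 * (\<mu> + real k + 1)"
      by (simp add: field_simps)
    then have "\<bar>w\<bar> / (real k + 1) * (\<bar>g\<bar> * \<bar>w\<bar> ^ k / fact k) \<le>
        1/2 * (\<mu> + real k + 1) * (\<bar>g\<bar> * \<bar>w\<bar> ^ k / fact k)"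
      by (intro mult_right_mono) auto
    then show "norm (rGamma (\<mu> + real (Suc k) + 1) * w ^ Suc k / fact (Suc k)) \<le>
        1/2 * norm (rGamma (\<mu> + real k + 1) * w ^ k / fact k)"
      unfolding rec g_def[symmetric] using k
      by (simp add: abs_mult power_abs mult_ac add_ac)
  qed simp
qed

text \<open>The coefficients satisfy
  \<open>rGamma (\<mu> + k) = (\<mu> + k) * rGamma (\<mu> + k + 1)\<close>. The summand
  \<open>\<mu>\<close> gives the first term on the right; the summand \<open>k\<close> cancels
  against the factorial and shifts the index, giving the second. With
  \<open>w = (z/2)\<^sup>2\<close>, \<open>S\<close> is \<open>bessel_I\<close> without its power
  prefactor.\<close>

lemma suminf_bessel_recurrence:
  fixes \<mu> w :: real
  defines "S \<equiv> \<lambda>\<mu>. \<Sum>k. rGamma (\<mu> + real k + 1) * w ^ k / fact k"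
  shows "S (\<mu> - 1) = \<mu> * S \<mu> + w * S (\<mu> + 1)"
proof -
  let ?f = "\<lambda>\<mu> k. rGamma (\<mu> + real k + 1) * w ^ k / fact k"
  let ?g = "\<lambda>k. real k * rGamma (\<mu> + real k + 1) * w ^ k / fact k"
  have S: "?f \<nu> sums S \<nu>" for \<nu>
    unfolding S_def by (intro summable_sums summable_bessel)
  have "(\<lambda>k. ?g (Suc k)) sums (w * S (\<mu> + 1))"
    using sums_mult[OF S[of "\<mu> + 1"], of w]
    by (rule sums_cong[THEN iffD1, rotated]) (simp add: field_simps del: of_nat_Suc, simp add: field_simps)
  \<comment> \<open>Undoing the shift adds only the term for \<open>k = 0\<close>, which vanishes
    because of the factor \<open>k\<close>.\<close>
  then have "?g sums (w * S (\<mu> + 1))"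
    using sums_Suc_iff[of ?g "w * S (\<mu> + 1)"] by simp
  then have "(\<lambda>k. \<mu> * ?f \<mu> k + ?g k) sums (\<mu> * S \<mu> + w * S (\<mu> + 1))"
    by (intro sums_add sums_mult S)
  also have "(\<lambda>k. \<mu> * ?f \<mu> k + ?g k) = ?f (\<mu> - 1)"
  proof
    fix k
    have "rGamma (\<mu> - 1 + real k + 1) = (\<mu> + real k) * rGamma (\<mu> + real k + 1)"
      using rGamma_plus1[of "\<mu> + real k"] by (simp add: algebra_simps)
    then show "\<mu> * ?f \<mu> k + ?g k = ?f (\<mu> - 1) k"
      by (simp add: field_simps)
  qed
  finally show ?thesis
    using S[of "\<mu> - 1"] sums_unique2 by blast
qed

lemma bessel_I_recurrence:
  assumes "z > 0"
  shows "bessel_I (\<nu> - 1) z - bessel_I (\<nu> + 1) z = 2 * \<nu> / z * bessel_I \<nu> z"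
proof -
  define S where "S \<mu> = (\<Sum>k. rGamma (\<mu> + real k + 1) * ((z/2)\<^sup>2) ^ k / fact k)" for \<mu>
  have I: "bessel_I \<mu> z = (z/2) powr \<mu> * S \<mu>" for \<mu>
    by (simp add: bessel_I_def S_def power_mult)
  have p: "(z/2) powr (\<nu> + 1) = (z/2) powr (\<nu> - 1) * (z/2)\<^sup>2"
       "(z/2) powr \<nu> = (z/2) powr (\<nu> - 1) * (z/2)"
    using assms by (simp_all add: powr_add powr_diff field_simps power2_eq_square)
  have rec: "S (\<nu> - 1) = \<nu> * S \<nu> + (z/2)\<^sup>2 * S (\<nu> + 1)"
    unfolding S_def by (rule suminf_bessel_recurrence)
  show ?thesis
    unfolding I p rec using assms by (simp add: algebra_simps)
qed

section \<open>The elementary orders 1/2 and -1/2\<close>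

text \<open>Induction from \<open>Gamma (1/2) = sqrt pi\<close>. In the series of
  \<open>bessel_I\<close> the factor \<open>4 ^ k * fact k\<close> cancels against
  \<open>(z/2) ^ (2 * k) / fact k\<close>, which leaves the terms of \<open>cosh\<close> or
  \<open>sinh\<close>.\<close>

lemma rGamma_half:
  "rGamma (real k + 1/2) = 4 ^ k * fact k / (fact (2 * k) * sqrt pi)"
proof (induction k)
  case 0
  then show ?case by (simp add: rGamma_inverse_Gamma Gamma_one_half_real field_simps)
next
  case (Suc k)
  have "(real k + 1/2) * rGamma (real (Suc k) + 1/2) = rGamma (real k + 1/2)"
    using rGamma_plus1[of "real k + 1/2"] by (simp add: add_ac)
  then have "rGamma (real (Suc k) + 1/2) = rGamma (real k + 1/2) / (real k + 1/2)"
    by (simp add: field_simps)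
  also have "\<dots> = 4 ^ Suc k * fact (Suc k) / (fact (2 * Suc k) * sqrt pi)"
    unfolding Suc by (simp add: divide_simps) (simp add: algebra_simps)
  finally show ?case .
qed

lemma bessel_I_minus_half:
  assumes "z > 0"
  shows "bessel_I (- (1/2)) z = sqrt (2 / (pi * z)) * cosh z"
proof -
  \<comment> \<open>The library series runs over all exponents with zero odd terms; reindexing along
    the even numbers drops those.\<close>
  have "(\<lambda>k. z ^ (2 * k) / fact (2 * k)) sums cosh z"
    using cosh_converges[of z]
    by (subst (asm) sums_mono_reindex[of "\<lambda>k. 2 * k", symmetric])
      (auto simp: strict_mono_def divide_inverse mult_ac elim!: evenE)
  then have "(\<lambda>k. 1 / sqrt pi * (z ^ (2 * k) / fact (2 * k))) sums (1 / sqrt pi * cosh z)"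
    by (rule sums_mult)
  also have "(\<lambda>k. 1 / sqrt pi * (z ^ (2 * k) / fact (2 * k))) =
      (\<lambda>k. rGamma (- (1/2) + real k + 1) * (z / 2) ^ (2 * k) / fact k)"
  proof
    fix k
    have w: "(z / 2) ^ (2 * k) = z ^ (2 * k) / 4 ^ k"
      unfolding power_divide by (simp add: power_mult)
    have "- (1/2) + real k + 1 = real k + 1/2" by simp
    then show "1 / sqrt pi * (z ^ (2 * k) / fact (2 * k)) =
        rGamma (- (1/2) + real k + 1) * (z / 2) ^ (2 * k) / fact k"
      by (simp only: rGamma_half w) (simp add: field_simps)
  qed
  finally have "(\<Sum>k. rGamma (- (1/2) + real k + 1) * (z / 2) ^ (2 * k) / fact k) = 1 / sqrt pi * cosh z"
    by (rule sums_unique[symmetric])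
  moreover have "(z / 2) powr (- (1/2)) = sqrt (2 / z)"
    using assms by (simp add: powr_minus powr_half_sqrt real_sqrt_divide field_simps)
  ultimately show ?thesis
    by (simp add: bessel_I_def real_sqrt_divide real_sqrt_mult)
qed

lemma bessel_I_half:
  assumes "z > 0"
  shows "bessel_I (1/2) z = sqrt (2 / (pi * z)) * sinh z"
proof -
  have "(\<lambda>k. z ^ (2 * k + 1) / fact (2 * k + 1)) sums sinh z"
    using sinh_converges[of z]
    by (subst (asm) sums_mono_reindex[of "\<lambda>k. 2 * k + 1", symmetric])
      (auto simp: strict_mono_def divide_inverse mult_ac elim!: oddE)
  then have "(\<lambda>k. 2 / (z * sqrt pi) * (z ^ (2 * k + 1) / fact (2 * k + 1))) sums
      (2 / (z * sqrt pi) * sinh z)"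
    by (rule sums_mult)
  also have "(\<lambda>k. 2 / (z * sqrt pi) * (z ^ (2 * k + 1) / fact (2 * k + 1))) =
      (\<lambda>k. rGamma (1/2 + real k + 1) * (z / 2) ^ (2 * k) / fact k)"
  proof
    fix k
    have w: "(z / 2) ^ (2 * k) = z ^ (2 * k) / 4 ^ k"
      unfolding power_divide by (simp add: power_mult)
    \<comment> \<open>The order 1/2 uses \<open>rGamma_half\<close> at \<open>Suc k\<close>. Writing
      both factorials through \<open>m\<close> and \<open>F\<close> exposes the factor
      \<open>m\<close> that cancels and leaves \<open>(2 * k + 1)!\<close> in the
      denominator.\<close>
    define m F where "m = real k + 1" and "F = (fact (2 * k + 1) :: real)"
    have f: "fact (2 * Suc k) = 2 * m * F" "fact (Suc k) = m * fact k" and "m > 0" "F > 0"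
      by (simp_all add: m_def F_def algebra_simps add_pos_nonneg)
    have "1/2 + real k + 1 = real (Suc k) + 1/2" by simp
    then show "2 / (z * sqrt pi) * (z ^ (2 * k + 1) / fact (2 * k + 1)) =
        rGamma (1/2 + real k + 1) * (z / 2) ^ (2 * k) / fact k"
      using assms \<open>m > 0\<close> \<open>F > 0\<close>
      by (simp only: rGamma_half w f flip: F_def) (simp add: field_simps)
  qed
  finally have "(\<Sum>k. rGamma (1/2 + real k + 1) * (z / 2) ^ (2 * k) / fact k) =
      2 / (z * sqrt pi) * sinh z"
    by (rule sums_unique[symmetric])
  then have "bessel_I (1/2) z = sqrt (z / 2) * (2 / (z * sqrt pi) * sinh z)"
    using assms by (simp only: bessel_I_def powr_half_sqrt)
  also have "\<dots> = sqrt (z / 2) * (2 / z) / sqrt pi * sinh z"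
    by simp
  also have "sqrt (z / 2) * (2 / z) = sqrt (2 / z)"
    using assms by (intro real_sqrt_unique[symmetric]) (auto simp: power_mult_distrib power2_eq_square)
  finally show ?thesis
    by (simp add: real_sqrt_divide real_sqrt_mult)
qed

section \<open>Macdonald functions of half-integer order\<close>

text \<open>The recurrence of \<open>bessel_I\<close> is applied at \<open>\<nu>\<close> and at
  \<open>- \<nu>\<close>. A shift of the order by one flips the sign of the sine, which turns the
  minus sign there into a plus sign here. For non-integer order all three values are plain
  quotients, without a limit.\<close>

lemma macdonald_K_recurrence:
  assumes "z > 0" and "\<nu> \<notin> \<int>"
  shows "macdonald_K (\<nu> + 1) z = macdonald_K (\<nu> - 1) z + 2 * \<nu> / z * macdonald_K \<nu> z"
proof -
  have ni: "\<nu> + 1 \<notin> \<int>" "\<nu> - 1 \<notin> \<int>"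
    using assms(2) Ints_diff[of "\<nu> + 1" 1] Ints_add[of "\<nu> - 1" 1] by auto
  have sn: "sin ((\<nu> + 1) * pi) = - sin (\<nu> * pi)" "sin ((\<nu> - 1) * pi) = - sin (\<nu> * pi)"
    by (simp_all add: algebra_simps sin_add sin_diff)
  have up: "bessel_I (\<nu> + 1) z = bessel_I (\<nu> - 1) z - 2 * \<nu> / z * bessel_I \<nu> z"
    using bessel_I_recurrence[OF assms(1), of \<nu>] by linarith
  have down: "bessel_I (- \<nu> - 1) z = bessel_I (- \<nu> + 1) z - 2 * \<nu> / z * bessel_I (- \<nu>) z"
    using bessel_I_recurrence[OF assms(1), of "- \<nu>"] by simp
  have args: "- (\<nu> + 1) = - \<nu> - 1" "- (\<nu> - 1) = - \<nu> + 1" by simp_all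
  show ?thesis
    using assms(2) ni
    unfolding macdonald_K_def macdonald_quotient_def args sn up down
    by (simp add: diff_divide_distrib add_divide_distrib algebra_simps)
qed

text \<open>Here \<open>cosh z - sinh z = exp (- z)\<close>. For the order -1/2 both the difference
  and the sine change sign. The two values start the recurrence.\<close>

lemma macdonald_K_half:
  assumes "z > 0"
  shows "macdonald_K (1/2) z = sqrt (pi / (2 * z)) * exp (- z)"
    and "macdonald_K (- (1/2)) z = sqrt (pi / (2 * z)) * exp (- z)"
proof -
  have ni: "(1/2 :: real) \<notin> \<int>" "(- (1/2) :: real) \<notin> \<int>"
    using fraction_not_in_Ints[of 2 1, where 'a = real] by auto
  have "(pi / 2 * sqrt (2 / (pi * z)))\<^sup>2 = pi / (2 * z)"
    using assms by (simp add: power_mult_distrib) (simp add: field_simps power2_eq_square)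
  then have c: "pi / 2 * sqrt (2 / (pi * z)) = sqrt (pi / (2 * z))"
    using assms by (intro real_sqrt_unique[symmetric]) auto
  have "pi / 2 * (bessel_I (- (1/2)) z - bessel_I (1/2) z) =
      pi / 2 * sqrt (2 / (pi * z)) * (cosh z - sinh z)"
    unfolding bessel_I_half[OF assms] bessel_I_minus_half[OF assms] by (simp add: algebra_simps)
  also have "\<dots> = sqrt (pi / (2 * z)) * exp (- z)"
    unfolding c by (simp add: cosh_minus_sinh)
  finally have d: "pi / 2 * (bessel_I (- (1/2)) z - bessel_I (1/2) z) =
    sqrt (pi / (2 * z)) * exp (- z)" .
  then show "macdonald_K (1/2) z = sqrt (pi / (2 * z)) * exp (- z)"
    using ni by (simp add: macdonald_K_def macdonald_quotient_def)
  from d show "macdonald_K (- (1/2)) z = sqrt (pi / (2 * z)) * exp (- z)"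
    using ni by (simp add: macdonald_K_def macdonald_quotient_def algebra_simps)
qed

text \<open>Each step of the recurrence multiplies by \<open>2 * \<nu> / z\<close> and adds, so only
  a polynomial in \<open>u = 1 / z\<close> changes: these are the Bessel polynomials of degrees 1 to
  5.\<close>

lemma macdonald_K_11_half:
  assumes "z > 0"
  shows "macdonald_K (11/2) z = sqrt (pi / (2 * z)) * exp (- z) *
    (945 / z ^ 5 + 945 / z ^ 4 + 420 / z ^ 3 + 105 / z\<^sup>2 + 15 / z + 1)"
proof -
  have ni: "(1/2 :: real) \<notin> \<int>" "(3/2 :: real) \<notin> \<int>" "(5/2 :: real) \<notin> \<int>"
      "(7/2 :: real) \<notin> \<int>" "(9/2 :: real) \<notin> \<int>"
    using fraction_not_in_Ints[of 2 1, where 'a = real] fraction_not_in_Ints[of 2 3, where 'a = real]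
      fraction_not_in_Ints[of 2 5, where 'a = real] fraction_not_in_Ints[of 2 7, where 'a = real]
      fraction_not_in_Ints[of 2 9, where 'a = real]
    by auto
  define u where "u = 1 / z"
  define K where "K = sqrt (pi / (2 * z)) * exp (- z)"
  have rec: "macdonald_K (\<nu> + 1) z = macdonald_K (\<nu> - 1) z + 2 * \<nu> * u * macdonald_K \<nu> z"
    if "\<nu> \<notin> \<int>" for \<nu>
    using macdonald_K_recurrence[OF assms that] by (simp add: u_def)
  have K1: "macdonald_K (1/2) z = K" "macdonald_K (- (1/2)) z = K"
    using macdonald_K_half[OF assms] by (simp_all add: K_def)
  have K3: "macdonald_K (3/2) z = K * (1 + u)"
    using rec[OF ni(1)] K1 by (simp add: algebra_simps eval_nat_numeral)
  have K5: "macdonald_K (5/2) z = K * (1 + 3 * u + 3 * u^2)"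
    using rec[OF ni(2)] K1 K3 by (simp add: algebra_simps eval_nat_numeral)
  have K7: "macdonald_K (7/2) z = K * (1 + 6 * u + 15 * u^2 + 15 * u^3)"
    using rec[OF ni(3)] K3 K5 by (simp add: algebra_simps eval_nat_numeral)
  have K9: "macdonald_K (9/2) z = K * (1 + 10 * u + 45 * u^2 + 105 * u^3 + 105 * u^4)"
    using rec[OF ni(4)] K5 K7 by (simp add: algebra_simps eval_nat_numeral)
  have "macdonald_K (11/2) z = K * (1 + 15 * u + 105 * u^2 + 420 * u^3 + 945 * u^4 + 945 * u^5)"
    using rec[OF ni(5)] K7 K9 by (simp add: algebra_simps eval_nat_numeral)
  then show ?thesis
    by (simp add: K_def u_def power_one_over algebra_simps)
qed

section \<open>Antiderivatives\<close>

lemma erf_has_real_derivative: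
  "(erf has_real_derivative 2 / sqrt pi * exp (- z\<^sup>2)) (at z)"
proof -
  \<comment> \<open>The interval from \<open>- M\<close> to \<open>M\<close> contains the base point
    0 and has \<open>z\<close> in its interior, so the derivative within it is a full
    derivative.\<close>
  define M where "M = \<bar>z\<bar> + 1"
  have "((\<lambda>u. LBINT t=ereal 0..ereal u. exp (- t\<^sup>2)) has_vector_derivative exp (- z\<^sup>2))
      (at z within {- M..M})"
    by (rule interval_integral_FTC2) (auto simp: M_def intro!: continuous_intros)
  moreover have "at z within {- M..M} = at z"
    by (rule at_within_interior) (auto simp: M_def)
  ultimately have "((\<lambda>u. LBINT t=0..ereal u. exp (- t\<^sup>2)) has_real_derivative exp (- z\<^sup>2)) (at z)"
    by (simp add: has_real_derivative_iff_has_vector_derivative zero_ereal_def)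
  from DERIV_cmult[OF this, of "2 / sqrt pi"] show ?thesis
    by (simp add: erf_def[abs_def])
qed

text \<open>Completing the square: the factor \<open>exp (b\<^sup>2 / (4 * a))\<close> in
  \<open>fW\<close> compensates the constant in the squared argument of \<open>erf\<close>. The
  inner derivative is \<open>sqrt a\<close>, and \<open>sqrt pi\<close> cancels.\<close>

lemma fW_has_real_derivative:
  assumes "a > 0"
  shows "(fW a b has_real_derivative 2 * sqrt a * fE a b x) (at x)"
proof -
  have inner: "((\<lambda>x. (2 * a * x + b) / (2 * sqrt a)) has_real_derivative sqrt a) (at x)"
    using assms by (auto intro!: derivative_eq_intros simp: field_simps)
  have sq: "((2 * a * x + b) / (2 * sqrt a))\<^sup>2 = a * x\<^sup>2 + b * x + b\<^sup>2 / (4 * a)"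
    using assms by (simp add: power_divide power_mult_distrib field_simps power2_eq_square)
  have "exp (b\<^sup>2 / (4 * a)) * exp (- ((2 * a * x + b) / (2 * sqrt a))\<^sup>2) = fE a b x"
    unfolding sq fE_def by (simp flip: exp_add)
  then show ?thesis
    using DERIV_cmult[OF DERIV_chain2[OF erf_has_real_derivative inner],
        of "sqrt pi * exp (b\<^sup>2 / (4 * a))"]
    by (simp add: fW_def[abs_def] algebra_simps)
qed

text \<open>Both derivatives, \<open>- (2 * a * x + b) * fE a b x\<close> and
  \<open>2 * sqrt a * fE a b x\<close>, are multiples of \<open>fE\<close>, so \<open>fE\<close>
  factors out. Passing from \<open>C\<close> to \<open>c\<close> removes the root of
  \<open>a\<close>; for rational \<open>R\<close> an identity of rational functions remains.\<close>

lemma antiderivative_fE_fW: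
  assumes "a > 0"
    and "(R has_real_derivative R') (at x)"
    and "C * (2 * sqrt a) = c"
    and "\<And>x. F x = fE a b x * R x + C * fW a b x"
    and "D = (R' - (2 * a * x + b) * R x + c) * fE a b x"
  shows "(F has_real_derivative D) (at x)"
proof -
  have E: "(fE a b has_real_derivative - (2 * a * x + b) * fE a b x) (at x)"
    unfolding fE_def by (auto intro!: derivative_eq_intros simp: algebra_simps)
  have "((\<lambda>x. fE a b x * R x + C * fW a b x) has_real_derivative
      - (2 * a * x + b) * fE a b x * R x + R' * fE a b x + C * (2 * sqrt a * fE a b x)) (at x)"
    by (intro DERIV_add DERIV_mult E assms DERIV_cmult fW_has_real_derivative)
  also have "- (2 * a * x + b) * fE a b x * R x + R' * fE a b x + C * (2 * sqrt a * fE a b x) = D"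
    using assms(3) unfolding assms(5) by (auto simp: algebra_simps)
  finally show ?thesis
    unfolding assms(4)[abs_def] .
qed

text \<open>The split-off \<open>sqrt a\<close> combines with the one in the derivative of
  \<open>fW\<close>, which makes \<open>c\<close> rational in \<open>a\<close>.\<close>

lemma powr_half_odd:
  fixes a :: real
  assumes "a > 0"
  shows "a powr (3/2) = a * sqrt a" "a powr (5/2) = a ^ 2 * sqrt a"
    "a powr (7/2) = a ^ 3 * sqrt a" "a powr (9/2) = a ^ 4 * sqrt a"
proof -
  have "a powr (real k + 1/2) = a ^ k * sqrt a" for k
    using assms by (simp add: powr_add powr_realpow powr_half_sqrt)
  from this[of 1] this[of 2] this[of 3] this[of 4]
  show "a powr (3/2) = a * sqrt a" "a powr (5/2) = a ^ 2 * sqrt a"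
    "a powr (7/2) = a ^ 3 * sqrt a" "a powr (9/2) = a ^ 4 * sqrt a"
    by simp_all
qed

section \<open>The five antiderivatives\<close>

text \<open>Apart from \<open>fE\<close>, the integrand consists of the powers of \<open>x\<close>
  from -2 to 3. The pole term of \<open>?R\<close> accounts for both negative powers, its quadratic
  part for the positive ones, and \<open>?c\<close> supplies the remaining constant.\<close>

lemma V3_has_real_derivative:
  assumes "a > 0" "b > 0" "x > 0"
  shows "(V3 a b has_real_derivative b ^ 5 * (x ^ 3 * fP b x * fE a b x)) (at x)"
proof (rule antiderivative_fE_fW[OF assms(1)])
  \<comment> \<open>\<open>?R\<close> and \<open>?C\<close> are the factors of \<open>fE\<close> and
    \<open>fW\<close> in \<open>V3\<close>, \<open>?R'\<close> is the termwise derivative, and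
    \<open>?c\<close> is \<open>?C * (2 * sqrt a)\<close> simplified. The other four proofs follow
    the same scheme.\<close>
  let ?R = "\<lambda>x. - (x * (60 * a\<^sup>2 * b ^ 4 - 2 * a * b ^ 6) / (8 * a ^ 3)
        + (420 * a\<^sup>2 * b ^ 3 - 26 * a * b ^ 5 + b ^ 7) / (8 * a ^ 3)
        + b ^ 5 * x\<^sup>2 / (2 * a)
        + 945 / x)"
  let ?R' = "- ((60 * a\<^sup>2 * b ^ 4 - 2 * a * b ^ 6) / (8 * a ^ 3) + b ^ 5 * x / a - 945 / x\<^sup>2)"
  let ?C = "- (15120 * a ^ 4 - 3360 * a ^ 3 * b\<^sup>2 + 360 * a\<^sup>2 * b ^ 4 - 24 * a * b ^ 6 + b ^ 8) / (16 * a powr (7/2))"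
  let ?c = "- (15120 * a ^ 4 - 3360 * a ^ 3 * b\<^sup>2 + 360 * a\<^sup>2 * b ^ 4 - 24 * a * b ^ 6 + b ^ 8) / (8 * a ^ 3)"
  \<comment> \<open>With \<open>x = 1 / u\<close> almost all denominators disappear, which keeps \<open>field_simps\<close> small.\<close>
  obtain u where x: "x = 1 / u" and "u > 0"
    using assms that[of "1 / x"] by simp
  show "(?R has_real_derivative ?R') (at x)"
    using assms
    by (auto intro!: derivative_eq_intros) (use \<open>u > 0\<close> in \<open>simp add: x field_simps, algebra\<close>)
  show "?C * (2 * sqrt a) = ?c"
    using assms by (simp add: powr_half_odd field_simps)
  show "V3 a b x = fE a b x * ?R x + ?C * fW a b x" for x
    by (simp add: V3_def del: minus_add_distrib minus_diff_eq)
  have "b ^ 5 * (x ^ 3 * fP b x) = ?R' - (2 * a * x + b) * ?R x + ?c"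
    unfolding x fP_def using assms \<open>u > 0\<close>
    by (simp add: field_simps) algebra
  then show "b ^ 5 * (x ^ 3 * fP b x * fE a b x) = (?R' - (2 * a * x + b) * ?R x + ?c) * fE a b x"
    by (simp only: mult.assoc [symmetric])
qed

text \<open>The powers now run from -4 to 1. The constant part of \<open>?R\<close> produces the top
  term \<open>b ^ 5 * x\<close>, the poles produce all negative powers, and \<open>?c\<close>
  corrects the constant term.\<close>

lemma V1_has_real_derivative:
  assumes "a > 0" "b > 0" "x > 0"
  shows "(V1 a b has_real_derivative b ^ 5 * (x * fP b x * fE a b x)) (at x)"
proof (rule antiderivative_fE_fW[OF assms(1)])
  let ?R = "\<lambda>x. - ((210 * a * b\<^sup>2 - 1260 * a\<^sup>2) / (2 * a * x)
        + b ^ 5 / (2 * a)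
        + 315 * b / x\<^sup>2
        + 315 / x ^ 3)"
  let ?R' = "(210 * a * b\<^sup>2 - 1260 * a\<^sup>2) / (2 * a * x\<^sup>2)
        + 630 * b / x ^ 3
        + 945 / x ^ 4"
  let ?C = "(2520 * a ^ 3 - 420 * a\<^sup>2 * b\<^sup>2 + 30 * a * b ^ 4 - b ^ 6) / (4 * a powr (3/2))"
  let ?c = "(2520 * a ^ 3 - 420 * a\<^sup>2 * b\<^sup>2 + 30 * a * b ^ 4 - b ^ 6) / (2 * a)"
  obtain u where x: "x = 1 / u" and "u > 0"
    using assms that[of "1 / x"] by simp
  show "(?R has_real_derivative ?R') (at x)"
    using assms
    by (auto intro!: derivative_eq_intros) (use \<open>u > 0\<close> in \<open>simp add: x field_simps, algebra\<close>)
  show "?C * (2 * sqrt a) = ?c"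
    using assms by (simp add: powr_half_odd field_simps)
  show "V1 a b x = fE a b x * ?R x + ?C * fW a b x" for x
    by (simp add: V1_def del: minus_add_distrib minus_diff_eq)
  have "b ^ 5 * (x * fP b x) = ?R' - (2 * a * x + b) * ?R x + ?c"
    unfolding x fP_def using assms \<open>u > 0\<close>
    by (simp add: field_simps) algebra
  then show "b ^ 5 * (x * fP b x * fE a b x) = (?R' - (2 * a * x + b) * ?R x + ?c) * fE a b x"
    by (simp only: mult.assoc [symmetric])
qed

text \<open>From here on the integrand divided by \<open>fE\<close> has only negative powers. Hence
  \<open>?c\<close> must cancel the constant term of \<open>- (2 * a * x + b) * ?R x\<close>: it is
  \<open>2 * a\<close> times the coefficient of \<open>1 / x\<close> in \<open>?R\<close>.\<close>

lemma Vm1_has_real_derivative: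
  assumes "a > 0" "b > 0" "x > 0"
  shows "(Vm1 a b has_real_derivative b ^ 5 * (1 / x * fP b x * fE a b x)) (at x)"
proof (rule antiderivative_fE_fW[OF assms(1)])
  let ?R = "\<lambda>x. (- 252 * a\<^sup>2 + 28 * a * b\<^sup>2 - b ^ 4) / x
        + (126 * a * b - 14 * b ^ 3) / x\<^sup>2
        + (126 * a - 77 * b\<^sup>2) / x ^ 3
        - 189 * b / x ^ 4
        - 189 / x ^ 5"
  let ?R' = "- (- 252 * a\<^sup>2 + 28 * a * b\<^sup>2 - b ^ 4) / x\<^sup>2
        - 2 * (126 * a * b - 14 * b ^ 3) / x ^ 3
        - 3 * (126 * a - 77 * b\<^sup>2) / x ^ 4
        + 756 * b / x ^ 5
        + 945 / x ^ 6"
  let ?C = "- sqrt a * (252 * a\<^sup>2 - 28 * a * b\<^sup>2 + b ^ 4)"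
  let ?c = "- 2 * a * (252 * a\<^sup>2 - 28 * a * b\<^sup>2 + b ^ 4)"
  obtain u where x: "x = 1 / u" and "u > 0"
    using assms that[of "1 / x"] by simp
  show "(?R has_real_derivative ?R') (at x)"
    using assms
    by (auto intro!: derivative_eq_intros) (use \<open>u > 0\<close> in \<open>simp add: x field_simps, algebra\<close>)
  show "?C * (2 * sqrt a) = ?c"
    using assms real_sqrt_mult_self[of a] by (simp add: powr_half_odd)
  show "Vm1 a b x = fE a b x * ?R x + ?C * fW a b x" for x
    by (simp add: Vm1_def del: minus_add_distrib minus_diff_eq)
  have "b ^ 5 * (1 / x * fP b x) = ?R' - (2 * a * x + b) * ?R x + ?c"
    unfolding x fP_def using assms \<open>u > 0\<close>
    by (simp add: field_simps) algebra
  then show "b ^ 5 * (1 / x * fP b x * fE a b x) = (?R' - (2 * a * x + b) * ?R x + ?c) * fE a b x"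
    by (simp only: mult.assoc [symmetric])
qed

lemma Vm3_has_real_derivative:
  assumes "a > 0" "b > 0" "x > 0"
  shows "(Vm3 a b has_real_derivative b ^ 5 * (1 / x ^ 3 * fP b x * fE a b x)) (at x)"
proof (rule antiderivative_fE_fW[OF assms(1)])
  let ?R = "\<lambda>x. (2 * a * b ^ 3 - 36 * a\<^sup>2 * b) / x\<^sup>2
        + (- 36 * a\<^sup>2 + 20 * a * b\<^sup>2 - b ^ 4) / x ^ 3
        + (72 * a ^ 3 - 4 * a\<^sup>2 * b\<^sup>2) / x
        + (54 * a * b - 12 * b ^ 3) / x ^ 4
        + (54 * a - 57 * b\<^sup>2) / x ^ 5
        - 135 * b / x ^ 6
        - 135 / x ^ 7"
  let ?R' = "- 2 * (2 * a * b ^ 3 - 36 * a\<^sup>2 * b) / x ^ 3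
        - 3 * (- 36 * a\<^sup>2 + 20 * a * b\<^sup>2 - b ^ 4) / x ^ 4
        - (72 * a ^ 3 - 4 * a\<^sup>2 * b\<^sup>2) / x\<^sup>2
        - 4 * (54 * a * b - 12 * b ^ 3) / x ^ 5
        - 5 * (54 * a - 57 * b\<^sup>2) / x ^ 6
        + 810 * b / x ^ 7
        + 945 / x ^ 8"
  let ?C = "4 * a powr (5/2) * (18 * a - b\<^sup>2)"
  let ?c = "8 * a ^ 3 * (18 * a - b\<^sup>2)"
  obtain u where x: "x = 1 / u" and "u > 0"
    using assms that[of "1 / x"] by simp
  show "(?R has_real_derivative ?R') (at x)"
    using assms
    by (auto intro!: derivative_eq_intros) (use \<open>u > 0\<close> in \<open>simp add: x field_simps, algebra\<close>)
  show "?C * (2 * sqrt a) = ?c"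
    using assms real_sqrt_mult_self[of a] by (simp add: powr_half_odd) algebra
  show "Vm3 a b x = fE a b x * ?R x + ?C * fW a b x" for x
    by (simp add: Vm3_def del: minus_add_distrib minus_diff_eq)
  have "b ^ 5 * (1 / x ^ 3 * fP b x) = ?R' - (2 * a * x + b) * ?R x + ?c"
    unfolding x fP_def using assms \<open>u > 0\<close>
    by (simp add: field_simps) algebra
  then show "b ^ 5 * (1 / x ^ 3 * fP b x * fE a b x) = (?R' - (2 * a * x + b) * ?R x + ?c) * fE a b x"
    by (simp only: mult.assoc [symmetric])
qed

text \<open>Matching the powers from -10 to 0 gives eleven equations for nine coefficients of
  \<open>?R\<close> and the constant \<open>?c\<close>. They are consistent, so no multiple of
  \<open>fE a b x / x\<close>, and with it no further special function, is left over.\<close>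

lemma Vm5_has_real_derivative:
  assumes "a > 0" "b > 0" "x > 0"
  shows "(Vm5 a b has_real_derivative b ^ 5 * (1 / x ^ 5 * fP b x * fE a b x)) (at x)"
proof (rule antiderivative_fE_fW[OF assms(1)])
  let ?R = "\<lambda>x. - (16 * a ^ 4 / x)
        + 8 * a ^ 3 * b / x\<^sup>2
        - 4 * (a\<^sup>2 * b\<^sup>2 - 2 * a ^ 3) / x ^ 3
        + 2 * (a * b ^ 3 - 6 * a\<^sup>2 * b) / x ^ 4
        + (- 12 * a\<^sup>2 + 12 * a * b\<^sup>2 - b ^ 4) / x ^ 5
        - 10 * (b ^ 3 - 3 * a * b) / x ^ 6
        - 15 * (3 * b\<^sup>2 - 2 * a) / x ^ 7
        - 105 * b / x ^ 8
        - 105 / x ^ 9"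
  let ?R' = "16 * a ^ 4 / x\<^sup>2
        - 16 * a ^ 3 * b / x ^ 3
        + 12 * (a\<^sup>2 * b\<^sup>2 - 2 * a ^ 3) / x ^ 4
        - 8 * (a * b ^ 3 - 6 * a\<^sup>2 * b) / x ^ 5
        - 5 * (- 12 * a\<^sup>2 + 12 * a * b\<^sup>2 - b ^ 4) / x ^ 6
        + 60 * (b ^ 3 - 3 * a * b) / x ^ 7
        + 105 * (3 * b\<^sup>2 - 2 * a) / x ^ 8
        + 840 * b / x ^ 9
        + 945 / x ^ 10"
  let ?C = "- 16 * a powr (9/2)"
  let ?c = "- 32 * a ^ 5"
  obtain u where x: "x = 1 / u" and "u > 0"
    using assms that[of "1 / x"] by simp
  show "(?R has_real_derivative ?R') (at x)"
    using assms
    by (auto intro!: derivative_eq_intros) (use \<open>u > 0\<close> in \<open>simp add: x field_simps, algebra\<close>)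
  show "?C * (2 * sqrt a) = ?c"
    using assms by (simp add: powr_half_odd field_simps power_numeral_reduce)
  show "Vm5 a b x = fE a b x * ?R x + ?C * fW a b x" for x
    by (simp add: Vm5_def del: minus_add_distrib minus_diff_eq)
  have "b ^ 5 * (1 / x ^ 5 * fP b x) = ?R' - (2 * a * x + b) * ?R x + ?c"
    unfolding x fP_def using assms \<open>u > 0\<close>
    by (simp add: field_simps) algebra
  then show "b ^ 5 * (1 / x ^ 5 * fP b x * fE a b x) = (?R' - (2 * a * x + b) * ?R x + ?c) * fE a b x"
    by (simp only: mult.assoc [symmetric])
qed

section \<open>Combining the closed form of the integrand with the antiderivatives\<close>

theorem mainTheorem6:
  fixes a b :: real and p :: int
  assumes "a > 0" and "b > 0" and "p \<in> {3, 1, - 1, - 3, - 5}"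
  shows "\<forall>x>0.
           sqrt (2 / pi) *
             (exp (- a * x\<^sup>2) * b powr (5 + 1 / 2) * x powr (of_int p + 1 / 2)
               * macdonald_K (11 / 2) (b * x))
             = b ^ 5 * (x powi p * fP b x * fE a b x)
         \<and> (V p a b has_real_derivative b ^ 5 * (x powi p * fP b x * fE a b x)) (at x)"
proof (intro allI impI conjI)
  fix x :: real assume x: "x > 0"
  have b: "b powr (5 + 1/2) = b ^ 5 * sqrt b"
    using assms(2) powr_realpow[of b 5] by (simp only: powr_add) (simp add: powr_half_sqrt)
  have xp: "x powr (of_int p + 1/2) = x powi p * sqrt x"
    using x by (simp add: powr_add powr_real_of_int' powr_half_sqrt)
  have K: "macdonald_K (11/2) (b * x) = sqrt (pi / (2 * (b * x))) * exp (- (b * x)) * fP b x"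
    using macdonald_K_11_half[of "b * x"] assms(2) x by (simp add: fP_def power_mult_distrib)
  have E: "fE a b x = exp (- a * x\<^sup>2) * exp (- (b * x))"
    by (simp add: fE_def flip: exp_add)
  \<comment> \<open>The normalising constant and the half powers of \<open>b\<close> and
    \<open>x\<close> are exactly what cancels the prefactor of \<open>macdonald_K\<close> at
    \<open>b * x\<close>.\<close>
  have 1: "sqrt (2 / pi) * sqrt b * sqrt x * sqrt (pi / (2 * (b * x))) = 1"
    using assms(2) x by (simp add: real_sqrt_mult real_sqrt_divide)
  have "sqrt (2 / pi) * (exp (- a * x\<^sup>2) * (b ^ 5 * sqrt b) * (x powi p * sqrt x) *
      (sqrt (pi / (2 * (b * x))) * exp (- (b * x)) * fP b x)) =
      (sqrt (2 / pi) * sqrt b * sqrt x * sqrt (pi / (2 * (b * x)))) *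
      (b ^ 5 * (x powi p * fP b x * fE a b x))"
    unfolding E by (simp only: mult_ac)
  then show "sqrt (2 / pi) * (exp (- a * x\<^sup>2) * b powr (5 + 1 / 2) * x powr (of_int p + 1 / 2)
      * macdonald_K (11 / 2) (b * x)) = b ^ 5 * (x powi p * fP b x * fE a b x)"
    unfolding b xp K 1 by simp
  show "(V p a b has_real_derivative b ^ 5 * (x powi p * fP b x * fE a b x)) (at x)"
    using assms(3) V3_has_real_derivative[OF assms(1,2) x] V1_has_real_derivative[OF assms(1,2) x]
      Vm1_has_real_derivative[OF assms(1,2) x] Vm3_has_real_derivative[OF assms(1,2) x]
      Vm5_has_real_derivative[OF assms(1,2) x]
    by (auto simp: V_def power_int_minus_divide)
qed

end
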